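(* For any $\sigma$-program $P$, the standard order $\le_P^{\mathrm{fin}}$ on $\mathrm{Lab}_P^{\mathrm{fin}}$ is a well-order of the order type $\omega$.
   Context: **Programs.** Let $\sigma=(n_1;m_1,\ldots,m_{n_2};k_1,\ldots,k_{n_3})$ be a finite signature with constant symbols $c_i^0$ ($i\le n_1$), operation symbols $f_i^{m_i}$ ($i\le n_2$), relation symbols $r_i^{k_i}$ ($i\le n_3$). A $\sigma$-program $P$ is a list $1:\mathrm{instruction}_1;\ \ldots;\ \ell_P-1:\mathrm{instruction}_{\ell_P-1};\ \ell_P:\text{stop}$ with $\ell_P\ge1$, where each instruction with label $\ell<\ell_P$ has one of the following forms (the $Z_j$ are symbols for registers holding elements of a structure, the $I_j$ are symbols for index registers holding positive integers): (1) $Z_j:=f_i^{m_i}(Z_{j_1},\ldots,Z_{j_{m_i}})$; (2) $Z_j:=c_i^0$; (3) $Z_{I_j}:=Z_{I_k}$; (4) if $r_i^{k_i}(Z_{j_1},\ldots,Z_{j_{k_i}})$ then goto $\ell_1'$ else goto $\ell_2'$; (5) if $I_j=I_k$ then goto $\ell_1'$ else goto $\ell_2'$; (6) $I_j:=1$; (7) $I_j:=I_j+1$; (11) goto $\ell_1'$ or goto $\ell_2'$; with $\ell_1',\ell_2'\in L_P=\{1,\ldots,\ell_P\}$. Let $L_P^{\circ}=\{1,\ldots,\ell_P-1\}$, $L_P^{\mathrm B}$ = the set of labels of instructions of types (4), (5), (11), and $L_P^{\mathrm{NB}}=L_P^\circ\setminus L_P^{\mathrm B}$. Put $\beta_P(\ell)=\ell+1$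 for $\ell\in L_P^{\mathrm{NB}}$ and, for $\ell\in L_P^{\mathrm B}$, $\beta_P^+(\ell)=\ell_1'$, $\beta_P^-(\ell)=\ell_2'$, where $\ell_1',\ell_2'$ are the labels occurring in the instruction labeled $\ell$. **Finite $P$-paths.** A finite $P$-path of length $s\ge1$ is a tuple $(\ell_1,\ldots,\ell_s)\in L_P^s$ with $\ell_1=1$, $\ell_s=\ell_P$, $\ell_t\in L_P^\circ$ for $t<s$, and for all $t<s$: $\ell_{t+1}=\beta_P(\ell_t)$ if $\ell_t\in L_P^{\mathrm{NB}}$, and $\ell_{t+1}\in\{\beta_P^+(\ell_t),\beta_P^-(\ell_t)\}$ if $\ell_t\in L_P^{\mathrm B}$. $\mathrm{Lab}_P^{\mathrm{fin}}$ is the set of all finite $P$-paths. **The order.** For $B^{(1)}=(\ell_{1,1},\ldots,\ell_{1,s_1})$ and $B^{(2)}=(\ell_{2,1},\ldots,\ell_{2,s_2})$ in $\mathrm{Lab}_P^{\mathrm{fin}}$, $B^{(1)}<_P^{\mathrm{fin}}B^{(2)}$ holds iff either $s_1<s_2$, or $s_1=s_2\ge3$ and there is $j\in\{2,\ldots,s_1-1\}$ with $\ell_{1,i}=\ell_{2,i}$ for all $i\in\{1,\ldots,j-1\}$ and $\ell_{1,j}<\ell_{2,j}$ (usual order on integers). $B^{(1)}\le_P^{\mathrm{fin}}B^{(2)}$ means $B^{(1)}<_P^{\mathrm{fin}}B^{(2)}$ or $B^{(1)}=B^{(2)}$; $\le_P^{\mathrm{fin}}$ is called the standard order on $\mathr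m{Lab}_P^{\mathrm{fin}}$.
   Formalization: Order type ω is asserted only when the set of finite P-paths is infinite; for every program the order is shown to be a well-order of type at most ω. The literal claim fails for the program "1: stop", whose only finite path is (1). *)

theory Defs
  imports Main
begin

unbundle cardinal_syntax

record signature =
  const_count :: nat
  op_arities :: "nat list"
  rel_arities :: "nat list"

text \<open>Symbols, registers, labels and path positions are all numbered from 1.\<close>

definition entry :: "'a list \<Rightarrow> nat \<Rightarrow> 'a" where
  "entry xs i = xs ! (i - 1)"

text \<open>
  In the order of the constructors:
  \<open>Z\<^sub>j := f\<^sub>i(Z\<^sub>j\<^sub>1, \<dots>)\<close>;
  \<open>Z\<^sub>j := c\<^sub>i\<close>;
  \<open>Z\<^bsub>I_j\<^esub> := Z\<^bsub>I_k\<^esub>\<close>;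
  if \<open>r\<^sub>i(Z\<^sub>j\<^sub>1, \<dots>)\<close> then goto \<open>l\<^sub>1\<close> else goto \<open>l\<^sub>2\<close>;
  if \<open>I\<^sub>j = I\<^sub>k\<close> then goto \<open>l\<^sub>1\<close> else goto \<open>l\<^sub>2\<close>;
  \<open>I\<^sub>j := 1\<close>; \<open>I\<^sub>j := I\<^sub>j + 1\<close>; goto \<open>l\<^sub>1\<close> or goto \<open>l\<^sub>2\<close>; stop.
  The selectors \<open>target_plus\<close> and \<open>target_minus\<close> are meaningful on
  branching instructions only.
\<close>

datatype instr =
    OpAssign nat nat "nat list"
  | ConstAssign nat nat
  | IndirectCopy nat nat
  | RelBranch nat "nat list" (target_plus: nat) (target_minus: nat)
  | IndexBranch nat nat (target_plus: nat) (target_minus: nat)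
  | IndexOne nat
  | IndexInc nat
  | NondetGoto (target_plus: nat) (target_minus: nat)
  | Stop

fun branching :: "instr \<Rightarrow> bool" where
  "branching (RelBranch _ _ _ _) = True"
| "branching (IndexBranch _ _ _ _) = True"
| "branching (NondetGoto _ _) = True"
| "branching _ = False"

text \<open>
  Admissible instructions at labels below the last one, for a program of length \<open>len\<close>;
  stop is not admissible there.
\<close>

fun nonstop_instr :: "signature \<Rightarrow> nat \<Rightarrow> instr \<Rightarrow> bool" where
  "nonstop_instr \<sigma> len (OpAssign j i js) \<longleftrightarrow>
     1 \<le> j \<and> i \<in> {1..length (op_arities \<sigma>)} \<and>
     length js = entry (op_arities \<sigma>) i \<and> (\<forall>k\<in>set js. 1 \<le> k)"
| "nonstop_instr \<sigma> len (ConstAssign j i) \<longleftrightarrow> 1 \<le> j \<and> i \<in> {1..const_count \<sigma>}"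
| "nonstop_instr \<sigma> len (IndirectCopy j k) \<longleftrightarrow> 1 \<le> j \<and> 1 \<le> k"
| "nonstop_instr \<sigma> len (RelBranch i js l1 l2) \<longleftrightarrow>
     i \<in> {1..length (rel_arities \<sigma>)} \<and>
     length js = entry (rel_arities \<sigma>) i \<and> (\<forall>k\<in>set js. 1 \<le> k) \<and>
     l1 \<in> {1..len} \<and> l2 \<in> {1..len}"
| "nonstop_instr \<sigma> len (IndexBranch j k l1 l2) \<longleftrightarrow>
     1 \<le> j \<and> 1 \<le> k \<and> l1 \<in> {1..len} \<and> l2 \<in> {1..len}"
| "nonstop_instr \<sigma> len (IndexOne j) \<longleftrightarrow> 1 \<le> j"
| "nonstop_instr \<sigma> len (IndexInc j) \<longleftrightarrow> 1 \<le> j"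
| "nonstop_instr \<sigma> len (NondetGoto l1 l2) \<longleftrightarrow> l1 \<in> {1..len} \<and> l2 \<in> {1..len}"
| "nonstop_instr \<sigma> len Stop \<longleftrightarrow> False"

definition is_program :: "signature \<Rightarrow> instr list \<Rightarrow> bool" where
  "is_program \<sigma> P \<longleftrightarrow>
     1 \<le> length P \<and>
     (\<forall>l\<in>{1..<length P}. nonstop_instr \<sigma> (length P) (entry P l)) \<and>
     entry P (length P) = Stop"

definition labels :: "instr list \<Rightarrow> nat set" where
  "labels P = {1..length P}"

definition labels_nonstop :: "instr list \<Rightarrow> nat set" where
  "labels_nonstop P = {1..<length P}"

definition labels_B :: "instr list \<Rightarrow> nat set" where
  "labels_B P = {l \<in> labels_nonstop P. branching (entry P l)}"

definition labels_NB :: "instr list \<Rightarrow> nat set" where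
  "labels_NB P = labels_nonstop P - labels_B P"

definition beta :: "instr list \<Rightarrow> nat \<Rightarrow> nat" where
  "beta P l = l + 1"

definition beta_plus :: "instr list \<Rightarrow> nat \<Rightarrow> nat" where
  "beta_plus P l = target_plus (entry P l)"

definition beta_minus :: "instr list \<Rightarrow> nat \<Rightarrow> nat" where
  "beta_minus P l = target_minus (entry P l)"

definition Lab_fin :: "instr list \<Rightarrow> nat list set" where
  "Lab_fin P = {B.
     1 \<le> length B \<and> set B \<subseteq> labels P \<and>
     entry B 1 = 1 \<and> entry B (length B) = length P \<and>
     (\<forall>t\<in>{1..<length B}.
        entry B t \<in> labels_nonstop P \<and>
        (entry B t \<in> labels_NB P \<longrightarrow> entry B (t + 1) = beta P (entry B t)) \<and>
        (entry B t \<in> labels_B P \<longrightarrow>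
           entry B (t + 1) \<in> {beta_plus P (entry B t), beta_minus P (entry B t)}))}"

definition path_less :: "nat list \<Rightarrow> nat list \<Rightarrow> bool" where
  "path_less B1 B2 \<longleftrightarrow>
     length B1 < length B2 \<or>
     (length B1 = length B2 \<and> 3 \<le> length B1 \<and>
      (\<exists>j\<in>{2..length B1 - 1}.
         (\<forall>i\<in>{1..j - 1}. entry B1 i = entry B2 i) \<and> entry B1 j < entry B2 j))"

text \<open>
  \<open>Lab_fin P\<close> can be finite (for the program consisting only of stop it is \<open>{[1]}\<close>) or empty,
  so the order type \<open>natLeq\<close> is attained exactly when it is infinite.
\<close>

definition std_order :: "instr list \<Rightarrow> nat list rel" where
  "std_order P = {(B1, B2).
     B1 \<in> Lab_fin P \<and> B2 \<in> Lab_fin P \<and> (path_less B1 B2 \<or> B1 = B2)}"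

end

theory Submission
  imports Defs
begin

text \<open>
  All finite paths start with label 1 and end with the label of stop, so restricting the position of
  the first difference to the interior costs nothing: on paths the standard order is the
  length-lexicographic order. Only finitely many paths are bounded by a given length, so every
  proper initial segment is finite, which keeps the order type below or equal to \<open>\<omega>\<close>.
\<close>

lemma lex_iff_nth_take:
  "(xs, ys) \<in> lex r \<longleftrightarrow> length xs = length ys \<and>
     (\<exists>i < length xs. take i xs = take i ys \<and> (xs ! i, ys ! i) \<in> r)"
proof
  assume lex: "(xs, ys) \<in> lex r"
  then have "length xs = length ys"
    by (simp add: lex_conv)
  with lex_take_index[OF lex] show "length xs = length ys \<and>
     (\<exists>i < length xs. take i xs = take i ys \<and> (xs ! i, ys ! i) \<in> r)"
    by blast
next
  assume "length xs = length ys \<and>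
     (\<exists>i < length xs. take i xs = take i ys \<and> (xs ! i, ys ! i) \<in> r)"
  then obtain i where i: "length xs = length ys" "i < length xs" "take i xs = take i ys"
    "(xs ! i, ys ! i) \<in> r"
    by blast
  have "xs = take i xs @ xs ! i # drop (Suc i) xs" "ys = take i xs @ ys ! i # drop (Suc i) ys"
    using id_take_nth_drop[of i xs] id_take_nth_drop[of i ys] i by simp_all
  with i show "(xs, ys) \<in> lex r"
    unfolding lex_conv by blast
qed

lemma path_less_iff_lenlex:
  assumes "B1 \<in> Lab_fin P" "B2 \<in> Lab_fin P"
  shows "path_less B1 B2 \<longleftrightarrow> (B1, B2) \<in> lenlex less_than"
proof -
  have ends: "B1 ! 0 = B2 ! 0" "B1 ! (length B1 - 1) = B2 ! (length B2 - 1)"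
    using assms by (auto simp: Lab_fin_def entry_def)
  have "(3 \<le> length B1 \<and> (\<exists>j\<in>{2..length B1 - 1}.
         (\<forall>i\<in>{1..j - 1}. entry B1 i = entry B2 i) \<and> entry B1 j < entry B2 j)) \<longleftrightarrow>
      (\<exists>i < length B1. take i B1 = take i B2 \<and> B1 ! i < B2 ! i)" (is "?L \<longleftrightarrow> ?R")
    if len: "length B1 = length B2"
  proof
    assume ?L
    then obtain j where j: "2 \<le> j" "j \<le> length B1 - 1" "B1 ! (j - 1) < B2 ! (j - 1)"
      and eq: "\<forall>i\<in>{1..j - 1}. B1 ! (i - 1) = B2 ! (i - 1)"
      by (auto simp: entry_def)
    have "B1 ! i = B2 ! i" if "i < j - 1" for i
      using bspec[OF eq, of "Suc i"] that by simp
    with j len have "take (j - 1) B1 = take (j - 1) B2"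
      by (intro nth_take_lemma) auto
    moreover have "j - 1 < length B1"
      using j by linarith
    ultimately show ?R
      using j by blast
  next
    assume ?R
    then obtain i where i: "i < length B1" "take i B1 = take i B2" "B1 ! i < B2 ! i"
      by blast
    have "i \<noteq> 0" "i \<noteq> length B1 - 1"
      using i ends len by (metis less_irrefl)+
    then have bnd: "3 \<le> length B1" "Suc i \<in> {2..length B1 - 1}"
      using i by auto
    have "entry B1 k = entry B2 k" if "k \<in> {1..Suc i - 1}" for k
    proof -
      have "k - 1 < i"
        using that by auto
      then show ?thesis
        unfolding entry_def using i(2) by (metis nth_take)
    qed
    with bnd i(3) show ?L
      by (intro conjI bexI[of _ "Suc i"]) (auto simp: entry_def)
  qed
  then show ?thesis
    unfolding path_less_def lenlex_conv mem_Collect_eq prod.case lex_iff_nth_take less_than_iff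
    by blast
qed

lemma std_order_eq_lenlex: "std_order P = Restr ((lenlex less_than)\<^sup>=) (Lab_fin P)"
  unfolding std_order_def using path_less_iff_lenlex by auto

lemma well_order_on_std_order: "well_order_on (Lab_fin P) (std_order P)"
proof -
  let ?lt = "lenlex less_than :: nat list rel"
  have wf: "wf ?lt"
    by (simp add: wf_lenlex)
  then have "(B, B) \<notin> ?lt" "(B, B') \<in> ?lt \<Longrightarrow> (B', B) \<notin> ?lt" for B B'
    by (simp_all add: wf_not_sym)
  then have "antisym (std_order P)"
    unfolding std_order_eq_lenlex antisym_def by blast
  moreover have "trans ?lt"
    by (intro lenlex_transI trans_less_than)
  then have "trans (std_order P)"
    unfolding std_order_eq_lenlex trans_def by blast
  moreover have "total ?lt"
    by (simp add: total_lenlex)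
  then have "total_on (Lab_fin P) (std_order P)"
    unfolding std_order_eq_lenlex total_on_def by blast
  moreover have "refl_on (Lab_fin P) (std_order P)" "std_order P \<subseteq> Lab_fin P \<times> Lab_fin P"
    unfolding std_order_eq_lenlex refl_on_def by blast+
  moreover have "wf (std_order P - Id)"
    using wf by (rule wf_subset) (auto simp: std_order_eq_lenlex)
  ultimately show ?thesis
    by (simp add: well_order_on_def linear_order_on_def partial_order_on_def preorder_on_def)
qed

lemma finite_underS_std_order: "finite (underS (std_order P) B)"
proof (rule finite_subset)
  show "underS (std_order P) B \<subseteq> {B'. set B' \<subseteq> labels P \<and> length B' \<le> length B}"
    by (auto simp: underS_def std_order_def path_less_def Lab_fin_def)
  show "finite {B'. set B' \<subseteq> labels P \<and> length B' \<le> length B}"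
    by (rule finite_lists_length_le) (simp add: labels_def)
qed

lemma ordLeq_natLeq_if_finite_underS:
  assumes "Well_order r" and fin: "\<And>a. a \<in> Field r \<Longrightarrow> finite (underS r a)"
  shows "r \<le>o natLeq"
proof (rule ccontr)
  assume "\<not> r \<le>o natLeq"
  then have "natLeq <o r"
    using assms(1) natLeq_Well_order not_ordLeq_iff_ordLess by blast
  then obtain a where a: "a \<in> Field r" "natLeq =o Restr r (underS r a)"
    using ordLess_iff_ordIso_Restr[OF assms(1) natLeq_Well_order] by blast
  then obtain f where "bij_betw f (Field natLeq) (Field (Restr r (underS r a)))"
    unfolding ordIso_def iso_def by blast
  moreover have "finite (Field (Restr r (underS r a)))"
    using fin[OF a(1)] by (rule finite_subset[rotated]) (auto simp: Field_def)
  ultimately show False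
    using bij_betw_finite by (auto simp: Field_natLeq)
qed

theorem theorem4p15:
  fixes \<sigma> :: signature and P :: "instr list"
  assumes "is_program \<sigma> P"
  shows "well_order_on (Lab_fin P) (std_order P) \<and>
    std_order P \<le>o natLeq \<and>
    (infinite (Lab_fin P) \<longrightarrow> std_order P =o natLeq)"
proof -
  note wo = well_order_on_std_order[of P]
  have le: "std_order P \<le>o natLeq"
    using well_order_on_Well_order[OF wo] finite_underS_std_order
    by (blast intro: ordLeq_natLeq_if_finite_underS)
  have "natLeq \<le>o std_order P" if "infinite (Lab_fin P)"
    using that infinite_iff_natLeq_ordLeq card_of_least[OF wo] ordLeq_transitive by blast
  with wo le show ?thesis
    by (simp add: ordIso_iff_ordLeq)
qed

end
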